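(* Let $k=2$, let $m\ge 2$, let $(t_i)$ be a knot sequence as in the context, let $A=(\langle N_i,N_j\rangle)_{i,j=1}^m$ be the Gram matrix of the piecewise linear B-splines $N_1,\dots,N_m$ on this knot sequence, and let $1\le n\le m$. Let $A_n$ be the upper left $n\times n$ block of $A$ and $B_n=A_n^{-1}=(b^n_{i,j})_{i,j=1}^n$. Then \[ |b_{i,j}^n|\leq \frac{36}{5}\,\frac{q^{|i-j|}}{\eta_{ij}}\qquad\text{for all } 1\leq i,j\leq n, \] where $q=2/3$ and $\eta_{ij}=t_{\max(i,j)+2}-t_{\min(i,j)}$.
   Context: Knots: $t_1,\dots,t_{m+2}$ are real numbers with $0=t_1=t_2<t_3<\dots<t_m<t_{m+1}=t_{m+2}=1$ (for $m=2$: $t_1=t_2=0$, $t_3=t_4=1$). For $1\le i\le m$, $N_i$ is the piecewise linear B-spline (order $k=2$) with support $[t_i,t_{i+2}]$, i.e. the continuous function on $[0,1]$ that is affine on each interval $[t_l,t_{l+1}]$ and satisfies $N_i(t_{j+1})=\delta_{i,j}$ for $1\le j\le m$. The inner product is $\langle f,g\rangle=\int_0^1 f(x)g(x)\,dx$. For $1\le n\le m$, $A_n=(\langle N_i,N_j\rangle)_{i,j=1}^n$, which is invertible since the $N_i$ are linearly independent. *)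

theory Defs
  imports "HOL-Analysis.Analysis" "Jordan_Normal_Form.Matrix"
begin

(* Both HOL-Analysis and Jordan_Normal_Form define vectors and matrices; all matrices below
   are those of Jordan_Normal_Form, since the dimension is a natural number parameter. *)
unbundle no vec_syntax
hide_const (open) Finite_Cartesian_Product.mat

(* The sequence is indexed from 1, only t 1, ..., t (m + 2) matter. *)
definition knot_sequence :: "nat \<Rightarrow> (nat \<Rightarrow> real) \<Rightarrow> bool" where
  "knot_sequence m t \<longleftrightarrow>
     t 1 = 0 \<and> t 2 = 0 \<and> t (m + 1) = 1 \<and> t (m + 2) = 1 \<and> strict_mono_on {2..m + 1} t"

(* Only the values of f on [0,1] are constrained; existence and uniqueness of such an f on
   [0,1] are proved below. On the degenerate intervals l = 1 and l = m + 1 affinity is void. *)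
definition linear_bspline :: "nat \<Rightarrow> (nat \<Rightarrow> real) \<Rightarrow> nat \<Rightarrow> (real \<Rightarrow> real) \<Rightarrow> bool" where
  "linear_bspline m t i f \<longleftrightarrow>
     continuous_on {0..1} f \<and>
     (\<forall>l\<in>{1..m + 1}. \<exists>a b. \<forall>x\<in>{t l..t (l + 1)}. f x = a * x + b) \<and>
     (\<forall>j\<in>{1..m}. f (t (j + 1)) = (if i = j then 1 else 0))"

definition inner_L2 :: "(real \<Rightarrow> real) \<Rightarrow> (real \<Rightarrow> real) \<Rightarrow> real" where
  "inner_L2 f g = integral {0..1} (\<lambda>x. f x * g x)"

(* Matrix positions are counted from 0, hence the index shift: position (i, j) holds the inner
   product of N (i + 1) and N (j + 1). *)
definition gram_matrix :: "nat \<Rightarrow> (nat \<Rightarrow> real \<Rightarrow> real) \<Rightarrow> real mat" where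
  "gram_matrix m N = mat m m (\<lambda>(i, j). inner_L2 (N (i + 1)) (N (j + 1)))"

definition upper_left_block :: "nat \<Rightarrow> 'a mat \<Rightarrow> 'a mat" where
  "upper_left_block n A = mat n n (\<lambda>(i, j). A $$ (i, j))"

definition knot_span :: "(nat \<Rightarrow> real) \<Rightarrow> nat \<Rightarrow> nat \<Rightarrow> real" where
  "knot_span t i j = t (max i j + 2) - t (min i j)"

lemma knot_mono:
  assumes "knot_sequence m t" "m \<ge> 2" "1 \<le> i" "i \<le> j" "j \<le> m + 2"
  shows "t i \<le> t j"
proof -
  have *: "t a \<le> t b" if "2 \<le> a" "a \<le> b" "b \<le> m + 1" for a b
    using assms(1) that strict_mono_on_leD[of "{2..m+1}" t a b]
    by (auto simp: knot_sequence_def)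
  define c where "c k = max 2 (min (m + 1) k)" for k
  have "t k = t (c k)" if "1 \<le> k" "k \<le> m + 2" for k
  proof -
    have "k = 1 \<or> 2 \<le> k \<and> k \<le> m + 1 \<or> k = m + 2" using that by arith
    then consider "k = 1" | "2 \<le> k" "k \<le> m + 1" | "k = m + 2" by blast
    then show ?thesis using assms(1,2) by cases (auto simp: c_def knot_sequence_def numeral_2_eq_2)
  qed
  moreover have "t (c i) \<le> t (c j)" by (rule *) (use assms in \<open>auto simp: c_def\<close>)
  ultimately show ?thesis using assms by simp
qed

lemma knot_less:
  assumes "knot_sequence m t" "2 \<le> l" "l \<le> m"
  shows "t l < t (l + 1)"
  using assms strict_mono_onD[of "{2..m+1}" t l "l+1"] by (auto simp: knot_sequence_def)

lemma linear_bspline_exists: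
  assumes K: "knot_sequence m t" and m: "m \<ge> 2" and i: "1 \<le> i" "i \<le> m"
  shows "\<exists>f. linear_bspline m t i f"
proof -
  define u where "u x = (if i = 1 then 1 else (x - t i) / (t (i + 1) - t i))" for x
  define v where "v x = (if i = m then 1 else (t (i + 2) - x) / (t (i + 2) - t (i + 1)))" for x
  define f where "f x = max 0 (min (u x) (v x))" for x
  note mono = knot_mono[OF K m]
  have du: "t i < t (i + 1)" if "i \<noteq> 1" using knot_less[OF K, of i] that i by auto
  have dv: "t (i + 1) < t (i + 2)" if "i \<noteq> m" using knot_less[OF K, of "i + 1"] that i by auto
  have u0: "u x \<le> 0" if "x \<le> t i" "i \<noteq> 1" for x
    using du that by (auto simp: u_def field_simps)
  have u1: "u x \<ge> 1" if "x \<ge> t (i + 1)" for x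
    using du that by (auto simp: u_def field_simps)
  have u01: "0 \<le> u x" "u x \<le> 1" if "x \<ge> t i" "x \<le> t (i + 1)" for x
    using du that by (auto simp: u_def field_simps)
  have v0: "v x \<le> 0" if "x \<ge> t (i + 2)" "i \<noteq> m" for x
    using dv that by (auto simp: v_def field_simps)
  have v1: "v x \<ge> 1" if "x \<le> t (i + 1)" for x
    using dv that by (auto simp: v_def field_simps)
  have v01: "0 \<le> v x" "v x \<le> 1" if "x \<le> t (i + 2)" "x \<ge> t (i + 1)" for x
    using dv that by (auto simp: v_def field_simps)
  have uaff: "\<exists>a b. \<forall>x. u x = a * x + b"
  proof (cases "i = 1")
    case True
    then have "\<forall>x. u x = 0 * x + 1" by (simp add: u_def)
    then show ?thesis by blast
  next
    case False
    then have "\<forall>x. u x = (1 / (t (i + 1) - t i)) * x + (- t i / (t (i + 1) - t i))"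
      by (simp add: u_def diff_divide_distrib)
    then show ?thesis by blast
  qed
  have vaff: "\<exists>a b. \<forall>x. v x = a * x + b"
  proof (cases "i = m")
    case True
    then have "\<forall>x. v x = 0 * x + 1" by (simp add: v_def)
    then show ?thesis by blast
  next
    case False
    then have "\<forall>x. v x = (- 1 / (t (i + 2) - t (i + 1))) * x + t (i + 2) / (t (i + 2) - t (i + 1))"
      by (simp add: v_def diff_divide_distrib)
    then show ?thesis by blast
  qed
  have cont: "continuous_on {0..1} f"
  proof -
    from uaff obtain a b where ab: "u = (\<lambda>x. a * x + b)" by auto
    from vaff obtain c d where cd: "v = (\<lambda>x. c * x + d)" by auto
    have "continuous_on {0..1} (\<lambda>x. max 0 (min (u x) (v x)))"
      unfolding ab cd by (intro continuous_intros)
    then show ?thesis by (simp add: f_def[abs_def])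
  qed
  have aff: "\<exists>a b. \<forall>x\<in>{t l..t (l + 1)}. f x = a * x + b" if l: "1 \<le> l" "l \<le> m + 1" for l
  proof -
    consider "l < i" | "l = i" | "l = i + 1" | "l > i + 1" by linarith
    then show ?thesis
    proof cases
      case 1
      then have "t (l + 1) \<le> t i" "i \<noteq> 1" using mono[of "l + 1" i] l i by auto
      then have "\<forall>x\<in>{t l..t (l + 1)}. f x = 0 * x + 0"
        by (intro ballI) (use u0 in \<open>force simp: f_def min_le_iff_disj intro!: max_absorb1\<close>)
      then show ?thesis by blast
    next
      case 2
      then have "\<forall>x\<in>{t l..t (l + 1)}. f x = u x" using u01 v1 by (force simp: f_def)
      then show ?thesis using uaff by auto
    next
      case 3
      then have "\<forall>x\<in>{t l..t (l + 1)}. f x = v x" using v01 u1 by (force simp: f_def)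
      then show ?thesis using vaff by auto
    next
      case 4
      then have "t (i + 2) \<le> t l" "i \<noteq> m" using mono[of "i + 2" l] l i by auto
      then have "\<forall>x\<in>{t l..t (l + 1)}. f x = 0 * x + 0"
        by (intro ballI) (use v0 in \<open>force simp: f_def min_le_iff_disj intro!: max_absorb1\<close>)
      then show ?thesis by blast
    qed
  qed
  have val: "f (t (j + 1)) = (if i = j then 1 else 0)" if j: "1 \<le> j" "j \<le> m" for j
  proof -
    consider "j < i" | "j = i" | "j > i" by linarith
    then show ?thesis
    proof cases
      case 1
      then have "t (j + 1) \<le> t i" "i \<noteq> 1" using mono[of "j + 1" i] j i by auto
      then show ?thesis using u0[of "t (j + 1)"] 1 by (simp add: f_def)
    next
      case 2
      have "u (t (i + 1)) = 1" using du by (cases "i = 1") (simp_all add: u_def)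
      moreover have "v (t (i + 1)) = 1" using dv by (cases "i = m") (simp_all add: v_def)
      ultimately show ?thesis using 2 by (simp add: f_def)
    next
      case 3
      then have "t (i + 2) \<le> t (j + 1)" "i \<noteq> m" using mono[of "i + 2" "j + 1"] j i by auto
      then show ?thesis using v0[of "t (j + 1)"] 3 by (simp add: f_def)
    qed
  qed
  show ?thesis unfolding linear_bspline_def using cont aff val by (intro exI[of _ f]) auto
qed

lemma knot_interval:
  assumes K: "knot_sequence m t" and m: "m \<ge> 2" and x: "0 \<le> x" "x \<le> 1"
  obtains l where "2 \<le> l" "l \<le> m" "t l \<le> x" "x \<le> t (l + 1)"
proof -
  have "x \<le> t (k + 1) \<Longrightarrow> \<exists>l. 2 \<le> l \<and> l \<le> k \<and> t l \<le> x \<and> x \<le> t (l + 1)"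
    if "2 \<le> k" for k
    using that
  proof (induction k rule: dec_induct)
    case base
    then show ?case using K x by (intro exI[of _ 2]) (auto simp: knot_sequence_def)
  next
    case (step k)
    show ?case
    proof (cases "x \<le> t (k + 1)")
      case True
      then show ?thesis using step by (meson le_SucI)
    next
      case False
      then show ?thesis using step by (intro exI[of _ "Suc k"]) auto
    qed
  qed
  from this[of m] show ?thesis using that m K x by (auto simp: knot_sequence_def)
qed

lemma linear_bspline_unique:
  assumes K: "knot_sequence m t" and m: "m \<ge> 2"
    and f: "linear_bspline m t i f" and g: "linear_bspline m t i g"
    and x: "0 \<le> x" "x \<le> 1"
  shows "f x = g x"
proof -
  obtain l where l: "2 \<le> l" "l \<le> m" "t l \<le> x" "x \<le> t (l + 1)"
    using knot_interval[OF K m x] .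
  have less: "t l < t (l + 1)" using knot_less[OF K] l by auto
  have "l \<in> {1..m + 1}" using l by auto
  then obtain a b c d where ab: "\<And>x. x \<in> {t l..t (l + 1)} \<Longrightarrow> f x = a * x + b"
    and cd: "\<And>x. x \<in> {t l..t (l + 1)} \<Longrightarrow> g x = c * x + d"
    using f g unfolding linear_bspline_def by metis
  have val: "f (t (j + 1)) = g (t (j + 1))" if "j \<in> {1..m}" for j
    using f g that unfolding linear_bspline_def by simp
  have "f (t l) = g (t l)" "f (t (l + 1)) = g (t (l + 1))"
    using val[of "l - 1"] val[of l] l by (auto simp: Suc_le_eq)
  then have 1: "a * t l + b = c * t l + d" and 2: "a * t (l + 1) + b = c * t (l + 1) + d"
    using ab cd less by auto
  then have "(a - c) * (t (l + 1) - t l) = 0" by (simp add: algebra_simps)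
  then have "a = c" using less by simp
  with 1 have "b = d" by simp
  with \<open>a = c\<close> show ?thesis using ab cd l by simp
qed

end

(* The Gram matrix is tridiagonal with diagonal (h k + h (k + 1)) / 3 and off-diagonal h (k + 1) / 6,
   where h lists the knot spacings, so each column of the inverse is a product of ratios
   off-diagonal / pivot divided by a diagonal term. Neglecting all but one elimination step, the
   pivots are at least h (k + 1) / 3 + h k / 4. With this, multiplying by one more ratio while
   enlarging the knot span by one interval shrinks (knot span) * (entry) by a factor 2 / 3; on the
   diagonal this product is at most 4. *)
theory Submission
  imports Defs "Jordan_Normal_Form.Determinant"
begin

section \<open>Inverting a symmetric tridiagonal matrix\<close>

definition tridiag :: "(nat \<Rightarrow> real) \<Rightarrow> (nat \<Rightarrow> real) \<Rightarrow> nat \<Rightarrow> nat \<Rightarrow> real" where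
  "tridiag a b i k = (if k = i then a i else if k = Suc i then b i else if i = Suc k then b k else 0)"

lemma sum_tridiag:
  assumes "i < n"
  shows "(\<Sum>k<n. tridiag a b i k * x k) =
    (case i of 0 \<Rightarrow> 0 | Suc p \<Rightarrow> b p * x p) + a i * x i + (if Suc i < n then b i * x (Suc i) else 0)"
proof -
  have "(\<Sum>k<n. tridiag a b i k * x k) =
    (\<Sum>k<n. (if i = Suc k then b k * x k else 0) + (if i = k then a k * x k else 0)
       + (if Suc i = k then b i * x k else 0))"
    by (intro sum.cong) (auto simp: tridiag_def)
  also have "\<dots> = (\<Sum>k<n. if i = Suc k then b k * x k else 0) + a i * x i
       + (if Suc i < n then b i * x (Suc i) else 0)"
    using assms by (simp add: sum.distrib)
  also have "(\<Sum>k<n. if i = Suc k then b k * x k else 0) = (case i of 0 \<Rightarrow> 0 | Suc p \<Rightarrow> b p * x p)"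
    using assms by (cases i) auto
  finally show ?thesis .
qed

definition tridiag_inv ::
  "(nat \<Rightarrow> real) \<Rightarrow> (nat \<Rightarrow> real) \<Rightarrow> (nat \<Rightarrow> real) \<Rightarrow> (nat \<Rightarrow> real) \<Rightarrow> nat \<Rightarrow> nat \<Rightarrow> real" where
  "tridiag_inv a b d e i j =
    (\<Prod>k\<in>{i..<j}. - b k / d k) * (\<Prod>k\<in>{j..<i}. - b k / e (Suc k)) / (d j + e j - a j)"

text \<open>\<open>d\<close> and \<open>e\<close> are the pivots of Gaussian elimination started from the first and from the
  last row, so above the diagonal \<open>d\<close> gives the ratio of consecutive entries of a column of the
  inverse, and below the diagonal \<open>e\<close> does.\<close>

lemma tridiag_mult_inv:
  assumes ij: "i < n" "j < n"
    and d0: "d 0 = a 0" and dS: "\<And>k. Suc k < n \<Longrightarrow> d (Suc k) = a (Suc k) - (b k)\<^sup>2 / d k"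
    and en: "e (n - 1) = a (n - 1)" and eS: "\<And>k. Suc k < n \<Longrightarrow> e k = a k - (b k)\<^sup>2 / e (Suc k)"
    and nz: "\<And>k. k < n \<Longrightarrow> d k \<noteq> 0" "\<And>k. k < n \<Longrightarrow> e k \<noteq> 0" "d j + e j - a j \<noteq> 0"
  shows "(\<Sum>k<n. tridiag a b i k * tridiag_inv a b d e k j) = (if i = j then 1 else 0)"
proof -
  define x where "x k = tridiag_inv a b d e k j" for k
  have up: "x k = - b k / d k * x (Suc k)" if "k < j" for k
    using that by (simp add: x_def tridiag_inv_def prod.atLeast_Suc_lessThan)
  have down: "x (Suc k) = - b k / e (Suc k) * x k" if "j \<le> k" for k
    using that by (simp add: x_def tridiag_inv_def prod.atLeastLessThan_Suc)
  have diag: "(d j + e j - a j) * x j = 1"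
    using nz by (simp add: x_def tridiag_inv_def)
  \<comment> \<open>\<open>L\<close> and \<open>R\<close> are the contributions of the left and
    right neighbours to row \<open>i\<close> of the product. Above the diagonal they are
    \<open>(d i - a i) * x i\<close> and \<open>- d i * x i\<close>, below it
    \<open>- e i * x i\<close> and \<open>(e i - a i) * x i\<close>, so both cancel against
    \<open>a i * x i\<close>. In row \<open>j\<close> both one-sided elimination formulas apply and
    leave \<open>(d j + e j - a j) * x j\<close>, which is why \<open>tridiag_inv\<close> is
    normalised by this factor.\<close>
  define L where "L = (case i of 0 \<Rightarrow> 0 | Suc p \<Rightarrow> b p * x p)"
  define R where "R = (if Suc i < n then b i * x (Suc i) else 0)"
  have L: "L = (d i - a i) * x i" if "i \<le> j"
    using that dS[of "i - 1"] d0 up[of "i - 1"] ij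
    by (cases i) (auto simp: L_def power2_eq_square)
  have L': "L = - e i * x i" if "j < i"
    using that down[of "i - 1"] nz ij by (cases i) (auto simp: L_def)
  have R: "R = (e i - a i) * x i" if "j \<le> i"
  proof (cases "Suc i < n")
    case True
    then show ?thesis using eS[of i] down[of i] that by (simp add: R_def power2_eq_square)
  next
    case False
    then have "i = n - 1" using ij by simp
    then show ?thesis using False en by (simp add: R_def)
  qed
  have R': "R = - d i * x i" if "i < j"
    using that up[of i] nz ij by (simp add: R_def)
  have "L + a i * x i + R = (if i = j then 1 else 0)"
    using L L' R R' diag by (cases i j rule: linorder_cases) (auto simp: algebra_simps)
  then show ?thesis
    using sum_tridiag[OF ij(1), of a b x] by (simp add: x_def L_def R_def)
qed

section \<open>The pivots for piecewise linear splines\<close>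

text \<open>The recursion takes the spacings instead of the matrix entries, so that the backward
  elimination is the same function applied to the reversed spacings.\<close>

fun pivot :: "(nat \<Rightarrow> real) \<Rightarrow> nat \<Rightarrow> real" where
  "pivot h 0 = (h 0 + h 1) / 3"
| "pivot h (Suc k) = (h (Suc k) + h (Suc (Suc k))) / 3 - (h (Suc k) / 6)\<^sup>2 / pivot h k"

text \<open>Only the weaker bound \<open>h (Suc i) / 3\<close> on the previous pivot enters the next
  step: the subtracted square is then at most \<open>h (Suc i) / 12\<close>, and 1/3 - 1/12 = 1/4.
  The spacings \<open>h 0\<close> and \<open>h n\<close> are allowed to vanish, as happens at
  repeated end knots.\<close>

lemma pivot_ge:
  assumes "i < n" "\<And>k. k \<le> n \<Longrightarrow> 0 \<le> h k" "\<And>k. 0 < k \<Longrightarrow> k < n \<Longrightarrow> 0 < h k"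
  shows "h (Suc i) / 3 + h i / 4 \<le> pivot h i"
  using assms(1)
proof (induction i)
  case 0
  then show ?case using assms(2)[of 0] by simp
next
  case (Suc i)
  define s where "s = h (Suc i)"
  have s: "0 < s" "0 \<le> h i" using assms(2)[of i] assms(3)[of "Suc i"] Suc.prems by (auto simp: s_def)
  then have p: "s / 3 \<le> pivot h i" using Suc by (simp add: s_def)
  have "(s / 6)\<^sup>2 / pivot h i \<le> (s / 6)\<^sup>2 / (s / 3)"
    using s p by (intro divide_left_mono) (auto intro!: mult_pos_pos)
  also have "\<dots> = s / 12" using s by (simp add: power2_eq_square)
  finally show ?case by (simp add: s_def add_divide_distrib)
qed

text \<open>\<open>H\<close> is the length of the current knot span, \<open>h\<close> its outermost interval and \<open>x\<close> the
  interval by which it grows. The constant works because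
  \<open>(H + x) h \<le> H (h + x) \<le> 4 H (h / 3 + x / 4)\<close>.\<close>

lemma decay_step:
  fixes h H x c p :: real
  assumes "0 < h" "h \<le> H" "0 \<le> x" "h / 3 + x / 4 \<le> p" "H * \<bar>c\<bar> \<le> K"
  shows "(H + x) * \<bar>- (h / 6) / p * c\<bar> \<le> 2 / 3 * K"
proof -
  have p: "0 < p" using assms by simp
  have "x * h \<le> x * H" "0 \<le> H * h" using assms by (auto intro: mult_left_mono)
  then have "(H + x) * h \<le> 4 * H * (h / 3 + x / 4)" by (simp add: algebra_simps)
  also have "\<dots> \<le> 4 * H * p" using assms by (intro mult_left_mono) auto
  finally have "(H + x) * (h / 6 / p) \<le> 2 / 3 * H" using p by (simp add: field_simps)
  then have "(H + x) * (h / 6 / p) * \<bar>c\<bar> \<le> 2 / 3 * H * \<bar>c\<bar>" by (rule mult_right_mono) simp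
  also have "\<dots> \<le> 2 / 3 * K" using assms by simp
  finally show ?thesis using assms p by (simp add: abs_mult mult.assoc)
qed

text \<open>Starting on the diagonal, where the knot span is \<delta>, each step along column
  \<open>j\<close> adds one interval to the span and one ratio to the product, so
  \<open>decay_step\<close> applies in both directions. The division by the diagonal term comes last
  and costs the factor 4.\<close>

lemma tridiag_inv_bound:
  fixes \<tau> h d e :: "nat \<Rightarrow> real"
  assumes h: "\<And>k. h k = \<tau> (Suc k) - \<tau> k"
    and nonneg: "\<And>k. k \<le> n \<Longrightarrow> 0 \<le> h k" and pos: "\<And>k. 0 < k \<Longrightarrow> k < n \<Longrightarrow> 0 < h k"
    and two: "\<And>k. k < n \<Longrightarrow> 0 < h k + h (Suc k)"
    and d: "\<And>k. k < n \<Longrightarrow> h (Suc k) / 3 + h k / 4 \<le> d k"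
    and e: "\<And>k. k < n \<Longrightarrow> h k / 3 + h (Suc k) / 4 \<le> e k"
    and ij: "i < n" "j < n"
  shows "\<bar>tridiag_inv (\<lambda>k. (h k + h (Suc k)) / 3) (\<lambda>k. h (Suc k) / 6) d e i j\<bar>
    \<le> 4 * ((2 / 3) ^ nat \<bar>int i - int j\<bar> / (\<tau> (max i j + 2) - \<tau> (min i j)))"
proof -
  define \<delta> where "\<delta> = \<tau> (j + 2) - \<tau> j"
  have \<delta>: "\<delta> = h j + h (Suc j)" by (simp add: \<delta>_def h)
  have mono: "\<tau> p \<le> \<tau> q" if "p \<le> q" "q \<le> Suc n" for p q
    using that
  proof (induction q rule: dec_induct)
    case (step k)
    then show ?case using nonneg[of k] h[of k] by auto
  qed simp
  define P where "P i = (\<Prod>k\<in>{i..<j}. - (h (Suc k) / 6) / d k)" for i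
  define Q where "Q i = (\<Prod>k\<in>{j..<i}. - (h (Suc k) / 6) / e (Suc k))" for i
  have up: "(\<tau> (j + 2) - \<tau> i) * \<bar>P i\<bar> \<le> (2 / 3) ^ (j - i) * \<delta>" if "i \<le> j" for i
    using that
  proof (induction i rule: inc_induct)
    case base
    then show ?case by (simp add: P_def \<delta>_def)
  next
    case (step k)
    have "P k = - (h (Suc k) / 6) / d k * P (Suc k)"
      using step by (simp add: P_def prod.atLeast_Suc_lessThan)
    \<comment> \<open>Moving up to row \<open>k\<close> adds the interval \<open>h k\<close> to the
      span; \<open>h (Suc k)\<close> is the interval shared by rows \<open>k\<close> and
      \<open>Suc k\<close>. The bound on \<open>d k\<close> gives the shared interval the weight 1/3
      and the new one 1/4, as \<open>decay_step\<close> requires.\<close>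
    moreover have "(\<tau> (j + 2) - \<tau> (Suc k) + h k) * \<bar>- (h (Suc k) / 6) / d k * P (Suc k)\<bar>
        \<le> 2 / 3 * ((2 / 3) ^ (j - Suc k) * \<delta>)"
    proof (rule decay_step)
      show "h (Suc k) \<le> \<tau> (j + 2) - \<tau> (Suc k)"
        using mono[of "Suc (Suc k)" "j + 2"] step ij by (simp add: h)
    qed (use step ij pos nonneg d in auto)
    moreover have "2 / 3 * ((2 / 3) ^ (j - Suc k) * \<delta>) = (2 / 3) ^ (j - k) * \<delta>"
      using Suc_diff_Suc[of k j] step by (metis mult.assoc power_Suc)
    moreover have "\<tau> (j + 2) - \<tau> (Suc k) + h k = \<tau> (j + 2) - \<tau> k" by (simp add: h)
    ultimately show ?case by (simp only:)
  qed
  have down: "(\<tau> (i + 2) - \<tau> j) * \<bar>Q i\<bar> \<le> (2 / 3) ^ (i - j) * \<delta>" if "j \<le> i" "i < n" for i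
    using that
  proof (induction i rule: dec_induct)
    case base
    then show ?case by (simp add: Q_def \<delta>_def)
  next
    case (step k)
    have "Q (Suc k) = - (h (Suc k) / 6) / e (Suc k) * Q k"
      using step by (simp add: Q_def prod.atLeastLessThan_Suc)
    \<comment> \<open>Moving down, the new interval is \<open>h (k + 2)\<close> and the pivot is
      \<open>e (Suc k)\<close>, whose bound has the weights in the mirrored order.\<close>
    moreover have "(\<tau> (k + 2) - \<tau> j + h (k + 2)) * \<bar>- (h (Suc k) / 6) / e (Suc k) * Q k\<bar>
        \<le> 2 / 3 * ((2 / 3) ^ (k - j) * \<delta>)"
    proof (rule decay_step)
      show "h (Suc k) \<le> \<tau> (k + 2) - \<tau> j"
        using mono[of j "Suc k"] step by (simp add: h)
      show "h (Suc k) / 3 + h (k + 2) / 4 \<le> e (Suc k)" using e[of "Suc k"] step by simp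
    qed (use step pos nonneg in auto)
    moreover have "\<tau> (k + 2) - \<tau> j + h (k + 2) = \<tau> (Suc k + 2) - \<tau> j" by (simp add: h)
    moreover have "2 / 3 * ((2 / 3) ^ (k - j) * \<delta>) = (2 / 3) ^ (Suc k - j) * \<delta>"
      using step by (simp add: Suc_diff_le)
    ultimately show ?case by (simp only:)
  qed
  define \<eta> where "\<eta> = \<tau> (max i j + 2) - \<tau> (min i j)"
  define g where "g = d j + e j - (h j + h (Suc j)) / 3"
  \<comment> \<open>One of the two products is always empty, so a single estimate serves both
    triangles.\<close>
  have PQ: "\<eta> * \<bar>P i * Q i\<bar> \<le> (2 / 3) ^ nat \<bar>int i - int j\<bar> * \<delta>"
  proof (cases "i \<le> j")
    case True
    then have "Q i = 1" "nat \<bar>int i - int j\<bar> = j - i" by (auto simp: Q_def)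
    then show ?thesis using up[OF True] True by (simp add: \<eta>_def max_def min_def)
  next
    case False
    then have "P i = 1" "nat \<bar>int i - int j\<bar> = i - j" by (auto simp: P_def)
    then show ?thesis using down[of i] False ij by (simp add: \<eta>_def max_def min_def)
  qed
  \<comment> \<open>The thirds from the two pivot bounds cancel against \<open>a j\<close>, and the
    remaining quarters add up to \<delta> / 4.\<close>
  have g: "\<delta> \<le> 4 * g" using d[OF ij(2)] e[OF ij(2)] unfolding g_def \<delta> by argo
  have \<delta>0: "0 < \<delta>" using two[of j] ij by (simp add: \<delta>)
  have "Suc (max i j) \<le> n" using ij by auto
  then have "\<delta> \<le> \<eta>"
    using mono[of "min i j" j] mono[of "j + 2" "max i j + 2"] ij(2) by (simp add: \<eta>_def \<delta>_def)
  then have \<eta>: "0 < \<eta>" using \<delta>0 by simp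
  have "\<eta> * \<bar>P i * Q i\<bar> \<le> (2 / 3) ^ nat \<bar>int i - int j\<bar> * (4 * g)"
    using PQ g by (meson mult_left_mono order_trans zero_le_power divide_nonneg_nonneg zero_le_numeral)
  then have "\<bar>P i * Q i\<bar> / g \<le> 4 * ((2 / 3) ^ nat \<bar>int i - int j\<bar> / \<eta>)"
    using \<eta> g \<delta>0 by (simp add: field_simps)
  moreover have "tridiag_inv (\<lambda>k. (h k + h (Suc k)) / 3) (\<lambda>k. h (Suc k) / 6) d e i j = P i * Q i / g"
    by (simp add: tridiag_inv_def P_def Q_def g_def)
  ultimately show ?thesis using g \<delta>0 by (simp add: \<eta>_def)
qed

section \<open>The Gram matrix\<close>

text \<open>Written in endpoint values, the integral can be evaluated for B-splines directly from
  their values 0 and 1 at the knots, without knowing their slopes.\<close>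

lemma has_integral_affine_mult:
  fixes f g :: "real \<Rightarrow> real"
  assumes "u \<le> v" and f: "\<forall>x\<in>{u..v}. f x = a * x + b" and g: "\<forall>x\<in>{u..v}. g x = c * x + d"
  shows "((\<lambda>x. f x * g x) has_integral
    (v - u) / 6 * (2 * f u * g u + 2 * f v * g v + f u * g v + f v * g u)) {u..v}"
proof -
  define F where "F x = a * c * x ^ 3 / 3 + (a * d + b * c) * x\<^sup>2 / 2 + b * d * x" for x
  have "((\<lambda>x. (a * x + b) * (c * x + d)) has_integral (F v - F u)) {u..v}"
  proof (rule fundamental_theorem_of_calculus[OF assms(1)])
    fix x
    have "(F has_real_derivative (a * x + b) * (c * x + d)) (at x within {u..v})"
      unfolding F_def by (auto intro!: derivative_eq_intros simp: power2_eq_square algebra_simps)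
    then show "(F has_vector_derivative (a * x + b) * (c * x + d)) (at x within {u..v})"
      by (simp add: has_real_derivative_iff_has_vector_derivative)
  qed
  moreover have "F v - F u = (v - u) / 6 * (2 * f u * g u + 2 * f v * g v + f u * g v + f v * g u)"
    using assms by (simp add: F_def field_simps power2_eq_square power3_eq_cube)
  ultimately show ?thesis
    using f g by (subst has_integral_cong[where g = "\<lambda>x. (a * x + b) * (c * x + d)"]) auto
qed

text \<open>The index \<open>k\<close> runs over the nondegenerate intervals from
  \<open>t (k + 1)\<close> to \<open>t (k + 2)\<close>. Only the splines \<open>k\<close> and
  \<open>k + 1\<close> are nonzero there, with value 1 at the left and at the right end
  respectively; the \<open>of_bool\<close> terms are the products of these endpoint values.\<close>

lemma inner_L2_linear_bspline:
  assumes K: "knot_sequence m t" and m: "m \<ge> 2"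
    and f: "linear_bspline m t i f" and g: "linear_bspline m t j g"
  shows "inner_L2 f g = (\<Sum>k\<in>{1..<m}. (t (k + 2) - t (k + 1)) / 6 *
    (2 * of_bool (i = k \<and> j = k) + 2 * of_bool (i = k + 1 \<and> j = k + 1)
      + of_bool (i = k \<and> j = k + 1) + of_bool (i = k + 1 \<and> j = k)))"
proof -
  define w where "w k = (t (k + 2) - t (k + 1)) / 6 *
    (2 * of_bool (i = k \<and> j = k) + 2 * of_bool (i = k + 1 \<and> j = k + 1)
      + of_bool (i = k \<and> j = k + 1) + of_bool (i = k + 1 \<and> j = k))" for k
  have piece: "((\<lambda>x. f x * g x) has_integral w k) {t (k + 1)..t (k + 2)}" if "1 \<le> k" "k < m" for k
  proof -
    have "k + 1 \<in> {1..m + 1}" using that by auto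
    then obtain a b c d where "\<forall>x\<in>{t (k + 1)..t (k + 2)}. f x = a * x + b"
      "\<forall>x\<in>{t (k + 1)..t (k + 2)}. g x = c * x + d"
      using f g unfolding linear_bspline_def by (metis add.assoc one_add_one)
    note * = has_integral_affine_mult[OF _ this]
    have "f (t (k + 1)) = of_bool (i = k)" "g (t (k + 1)) = of_bool (j = k)"
      "f (t (k + 2)) = of_bool (i = k + 1)" "g (t (k + 2)) = of_bool (j = k + 1)"
      using f g that bspec[of "{1..m}" _ "k + 1"] unfolding linear_bspline_def by auto
    moreover have "t (k + 1) \<le> t (k + 2)" using knot_mono[OF K m, of "k + 1" "k + 2"] that by simp
    ultimately show ?thesis using * by (simp add: w_def of_bool_conj algebra_simps)
  qed
  have "((\<lambda>x. f x * g x) has_integral (\<Sum>k\<in>{1..<q}. w k)) {t 2..t (q + 1)}" if "1 \<le> q" "q \<le> m" for q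
    using that
  proof (induction q rule: dec_induct)
    case base
    show ?case using has_integral_refl(2)[of "\<lambda>x. f x * g x" "t 2"] by (simp add: numeral_2_eq_2)
  next
    case (step q)
    have "((\<lambda>x. f x * g x) has_integral ((\<Sum>k\<in>{1..<q}. w k) + w q)) {t 2..t (q + 2)}"
    proof (rule has_integral_combine)
      show "t 2 \<le> t (q + 1)" "t (q + 1) \<le> t (q + 2)"
        using knot_mono[OF K m, of 2 "q + 1"] knot_mono[OF K m, of "q + 1" "q + 2"] step by auto
    qed (use step piece[of q] in auto)
    then show ?case using step by (simp add: sum.atLeastLessThan_Suc)
  qed
  from this[of m] have "((\<lambda>x. f x * g x) has_integral (\<Sum>k\<in>{1..<m}. w k)) {0..1}"
    using m K by (simp add: knot_sequence_def)
  then show ?thesis by (simp add: inner_L2_def w_def integral_unique)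
qed

lemma gram_matrix_entry:
  fixes t :: "nat \<Rightarrow> real"
  defines "h \<equiv> \<lambda>k. t (k + 2) - t (k + 1)"
  assumes K: "knot_sequence m t" and m: "m \<ge> 2"
    and N: "\<And>i. 1 \<le> i \<Longrightarrow> i \<le> m \<Longrightarrow> linear_bspline m t i (N i)" and ij: "i < m" "j < m"
  shows "gram_matrix m N $$ (i, j) = tridiag (\<lambda>k. (h k + h (Suc k)) / 3) (\<lambda>k. h (Suc k) / 6) i j"
proof -
  \<comment> \<open>These zeros let the first and last rows, which receive only one interval of the
    sum, follow the same formula as the inner rows.\<close>
  have ends: "h 0 = 0" "h m = 0" using K by (auto simp: h_def knot_sequence_def numeral_2_eq_2)
  have "gram_matrix m N $$ (i, j) = inner_L2 (N (i + 1)) (N (j + 1))"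
    using ij by (simp add: gram_matrix_def)
  also have "\<dots> = (\<Sum>k\<in>{1..<m}. h k / 6 * (2 * of_bool (i + 1 = k \<and> j + 1 = k) + 2 * of_bool (i = k \<and> j = k)
      + of_bool (i + 1 = k \<and> j = k) + of_bool (i = k \<and> j + 1 = k)))"
    using inner_L2_linear_bspline[OF K m N N, of "i + 1" "j + 1"] ij by (simp add: h_def)
  \<comment> \<open>Only the two intervals in the support of \<open>N (i + 1)\<close>, namely
    \<open>k = i\<close> and \<open>k = Suc i\<close>, survive in row \<open>i\<close>.\<close>
  also have "\<dots> = (\<Sum>k\<in>{1..<m}. (if k = Suc i then h k / 6 * (2 * of_bool (j = i) + of_bool (j = Suc i)) else 0)
      + (if k = i then h k / 6 * (2 * of_bool (j = i) + of_bool (i = Suc j)) else 0))"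
    by (intro sum.cong) auto
  also have "\<dots> = (if Suc i < m then h (Suc i) / 6 * (2 * of_bool (j = i) + of_bool (j = Suc i)) else 0)
      + (if 1 \<le> i then h i / 6 * (2 * of_bool (j = i) + of_bool (i = Suc j)) else 0)"
    using ij by (simp add: sum.distrib)
  also have "\<dots> = tridiag (\<lambda>k. (h k + h (Suc k)) / 3) (\<lambda>k. h (Suc k) / 6) i j"
  proof -
    have "i = 0 \<Longrightarrow> h i = 0" "\<not> Suc i < m \<Longrightarrow> h (Suc i) = 0"
      using ends ij by (auto simp: not_less le_less_Suc_eq dest!: le_antisym[of m "Suc i"])
    then show ?thesis using ij by (cases "i = 0") (auto simp: tridiag_def)
  qed
  finally show ?thesis .
qed

theorem theorem4p3:
  fixes m n :: nat and t :: "nat \<Rightarrow> real" and N :: "nat \<Rightarrow> real \<Rightarrow> real"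
  assumes "m \<ge> 2"
    and "knot_sequence m t"
    and "\<And>i. 1 \<le> i \<Longrightarrow> i \<le> m \<Longrightarrow> linear_bspline m t i (N i)"
    and "1 \<le> n" and "n \<le> m"
  shows "\<exists>B \<in> carrier_mat n n.
    inverts_mat (upper_left_block n (gram_matrix m N)) B \<and>
    inverts_mat B (upper_left_block n (gram_matrix m N)) \<and>
    (\<forall>i\<in>{1..n}. \<forall>j\<in>{1..n}.
       \<bar>B $$ (i - 1, j - 1)\<bar>
         \<le> 36 / 5 * ((2 / 3) ^ nat \<bar>int i - int j\<bar> / knot_span t i j))"
proof -
  note m = assms(1) and K = assms(2) and N = assms(3) and n = assms(4,5)
  define h where "h k = t (k + 2) - t (k + 1)" for k
  define a where "a k = (h k + h (Suc k)) / 3" for k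
  define b where "b k = h (Suc k) / 6" for k
  define d where "d = pivot h"
  \<comment> \<open>Elimination from the last row is elimination from the first row for the reflected spacings.\<close>
  define e where "e i = pivot (\<lambda>k. h (n - k)) (n - 1 - i)" for i
  have nonneg: "0 \<le> h k" if "k \<le> n" for k
    using knot_mono[OF K m, of "k + 1" "k + 2"] that n by (simp add: h_def)
  have pos: "0 < h k" if "0 < k" "k < m" for k
    using knot_less[OF K, of "k + 1"] that by (simp add: h_def)
  \<comment> \<open>Only \<open>h 0\<close> and \<open>h m\<close> can vanish, and they are not
    adjacent because \<open>m\<close> is at least 2. This makes all pivots and diagonal terms
    positive.\<close>
  have two: "0 < h k + h (Suc k)" if "k < n" for k
  proof (cases "k = 0")
    case True
    then show ?thesis using pos[of 1] nonneg[of 0] m by simp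
  next
    case False
    then show ?thesis using pos[of k] nonneg[of "Suc k"] n that by simp
  qed
  have d_ge: "h (Suc k) / 3 + h k / 4 \<le> d k" if "k < n" for k
    unfolding d_def by (rule pivot_ge[OF that]) (use nonneg pos n in auto)
  have e_ge: "h k / 3 + h (Suc k) / 4 \<le> e k" if "k < n" for k
  proof -
    have "n - Suc (n - 1 - k) = k" "n - (n - 1 - k) = Suc k" using that by auto
    then show ?thesis
      using pivot_ge[of "n - 1 - k" n "\<lambda>k. h (n - k)"] nonneg pos n that by (simp add: e_def)
  qed
  have lt: "0 < h (Suc k) / 3 + h k / 4" "0 < h k / 3 + h (Suc k) / 4" if "k < n" for k
    using two[OF that] nonneg[of k] nonneg[of "Suc k"] that by auto
  have dpos: "0 < d k" and epos: "0 < e k" and gpos: "0 < d k + e k - a k" if "k < n" for k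
    using d_ge[OF that] e_ge[OF that] lt[OF that] two[OF that] by (auto simp: a_def)
  have eS: "e k = a k - (b k)\<^sup>2 / e (Suc k)" if "Suc k < n" for k
  proof -
    \<comment> \<open>Naming \<open>r\<close> turns the argument \<open>n - 1 - k\<close> into
      \<open>Suc r\<close>, which exposes the recursive equation of \<open>pivot\<close>.\<close>
    define r where "r = n - 1 - Suc k"
    have r: "n - 1 - Suc k = r" "n - 1 - k = Suc r" "n - Suc r = Suc k" "n - Suc (Suc r) = k"
      using that by (auto simp: r_def)
    then show ?thesis unfolding e_def r(1,2) by (simp add: a_def b_def add.commute)
  qed
  have inv: "(\<Sum>k<n. tridiag a b i k * tridiag_inv a b d e k j) = (if i = j then 1 else 0)"
    if "i < n" "j < n" for i j
  proof (rule tridiag_mult_inv[OF that])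
    show "e k = a k - (b k)\<^sup>2 / e (Suc k)" if "Suc k < n" for k using eS[OF that] .
    \<comment> \<open>Truncation to the block leaves the last diagonal entry intact, including
      \<open>h n\<close>, which is positive when \<open>n < m\<close>; hence the reflected spacings
      start with \<open>h n\<close>.\<close>
    show "e (n - 1) = a (n - 1)" using n by (simp add: e_def a_def add.commute)
  qed (use dpos epos gpos[OF that(2)] in \<open>force simp: d_def a_def b_def\<close>)+
  define A where "A = upper_left_block n (gram_matrix m N)"
  define B where "B = mat n n (\<lambda>(i, j). tridiag_inv a b d e i j)"
  have A: "A \<in> carrier_mat n n" by (simp add: A_def upper_left_block_def)
  have B: "B \<in> carrier_mat n n" by (simp add: B_def)
  have Aij: "A $$ (i, j) = tridiag a b i j" if "i < n" "j < n" for i j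
    using gram_matrix_entry[OF K m N, of i j] that n
    by (simp add: A_def upper_left_block_def a_def[abs_def] b_def[abs_def] h_def)
  have AB: "A * B = 1\<^sub>m n"
  proof (rule eq_matI)
    fix i j assume "i < dim_row (1\<^sub>m n :: real mat)" "j < dim_col (1\<^sub>m n :: real mat)"
    then have ij: "i < n" "j < n" by auto
    have "(A * B) $$ (i, j) = (\<Sum>k<n. A $$ (i, k) * B $$ (k, j))"
      using A B ij by (simp add: scalar_prod_def atLeast0LessThan)
    also have "\<dots> = (\<Sum>k<n. tridiag a b i k * tridiag_inv a b d e k j)"
      using ij by (intro sum.cong) (auto simp: Aij B_def)
    finally show "(A * B) $$ (i, j) = 1\<^sub>m n $$ (i, j)" using inv[OF ij] ij by simp
  qed (use A B in auto)
  then have BA: "B * A = 1\<^sub>m n" by (rule mat_mult_left_right_inverse[OF A B])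
  have "\<bar>B $$ (i - 1, j - 1)\<bar> \<le> 36 / 5 * ((2 / 3) ^ nat \<bar>int i - int j\<bar> / knot_span t i j)"
    if "i \<in> {1..n}" "j \<in> {1..n}" for i j
  proof -
    define i' j' where "i' = i - 1" and "j' = j - 1"
    have ij: "i = Suc i'" "j = Suc j'" "i' < n" "j' < n" using that by (auto simp: i'_def j'_def)
    have "B $$ (i', j') = tridiag_inv (\<lambda>k. (h k + h (Suc k)) / 3) (\<lambda>k. h (Suc k) / 6) d e i' j'"
      using ij by (simp add: B_def a_def[abs_def] b_def[abs_def])
    moreover have "\<bar>tridiag_inv (\<lambda>k. (h k + h (Suc k)) / 3) (\<lambda>k. h (Suc k) / 6) d e i' j'\<bar>
      \<le> 4 * ((2 / 3) ^ nat \<bar>int i' - int j'\<bar> / (t (Suc (max i' j' + 2)) - t (Suc (min i' j'))))"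
      \<comment> \<open>The shifted knots convert positions counted from 0 to splines counted from
        1, so the span in the bound becomes \<open>knot_span t i j\<close>.\<close>
      by (rule tridiag_inv_bound[where n = n and \<tau> = "\<lambda>k. t (Suc k)"])
        (use nonneg pos two d_ge e_ge n ij in \<open>auto simp: h_def\<close>)
    ultimately have "\<bar>B $$ (i', j')\<bar> \<le> 4 * ((2 / 3) ^ nat \<bar>int i - int j\<bar> / knot_span t i j)"
      by (simp add: ij knot_span_def)
    \<comment> \<open>The argument yields the constant 4, which is smaller than 36/5.\<close>
    also have "\<dots> \<le> 36 / 5 * ((2 / 3) ^ nat \<bar>int i - int j\<bar> / knot_span t i j)"
    proof (rule mult_right_mono)
      have "t (min i j) \<le> t (max i j + 2)"
        using knot_mono[OF K m, of "min i j" "max i j + 2"] that n by auto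
      then show "0 \<le> (2 / 3) ^ nat \<bar>int i - int j\<bar> / knot_span t i j"
        by (simp add: knot_span_def)
    qed simp
    finally show ?thesis by (simp add: i'_def j'_def)
  qed
  with A B AB BA show ?thesis
    by (intro bexI[OF _ B]) (auto simp: inverts_mat_def A_def[symmetric])
qed

end
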